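(* Let $N\ge1$ and let $f:\{0,1\}^N\to\{0,1\}$ be a non-constant symmetric Boolean function. Then $Q_0(f)\ge (N+1)/4$.
   Context: $f$ is symmetric if $f(X)$ depends only on the Hamming weight $|X|$ (number of 1s in $X$). Quantum networks: the input $X=(x_0,\ldots,x_{N-1})\in\{0,1\}^N$ is given as a black-box. A quantum network with $T$ queries acts on $m$ qubits (for some $m$) and is a sequence of unitary transformations $U_0,O,U_1,O,\ldots,U_{T-1},O,U_T$ applied in this order to the initial state $|0\rangle$, where the $U_j$ are arbitrary unitaries on $m$ qubits not depending on $X$, and the query $O$ (depending on $X$) maps each basis state $|i,b,z\rangle$ to $|i,b\oplus x_i,z\rangle$; here $i$ consists of $\lceil\log_2 N\rceil$ bits, $b$ is one bit, and $z$ consists of the remaining $m-\lceil\log_2 N\rceil-1$ bits (if $i\ge N$, the query leaves the basis state unchanged). Zero-error computation: the output is obtained by measuring the two rightmost bits of the final state in the computational basis. If the first of these two bits is 0 the answer is "inconclusive"; otherwise the second bit is the answer. The network computes $f$ with zero error if for every $X\in\{0,1\}^N$ the answer, whenever it is not "inconclusive", equals $f(X)$ with certainty, and the probability of "inconclusive" is less than $1/2$. $Q_0(f)$ is the minimum $T$ such that some quantum network with $T$ queries computes $f$ with zero error. *)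

theory Defs
  imports
    Complex_Main
    "HOL-Library.Log_Nat"
    "HOL-Library.Extended_Real"
    "Jordan_Normal_Form.Schur_Decomposition"
begin

(* Inputs X = (x_0, ..., x_{N-1}) are Boolean lists of length N, with x_i = X ! i.
   A Boolean function f on {0,1}^N is a predicate on lists; only its values on lists of
   length N matter below. *)

definition inputs :: "nat \<Rightarrow> bool list set" where
  "inputs N = {X. length X = N}"

definition hamming_weight :: "bool list \<Rightarrow> nat" where
  "hamming_weight X = card {i. i < length X \<and> X ! i}"

definition symmetric_fun :: "nat \<Rightarrow> (bool list \<Rightarrow> bool) \<Rightarrow> bool" where
  "symmetric_fun N f \<longleftrightarrow>
     (\<forall>X\<in>inputs N. \<forall>Y\<in>inputs N. hamming_weight X = hamming_weight Y \<longrightarrow> f X = f Y)"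

definition nonconstant_fun :: "nat \<Rightarrow> (bool list \<Rightarrow> bool) \<Rightarrow> bool" where
  "nonconstant_fun N f \<longleftrightarrow> (\<exists>X\<in>inputs N. \<exists>Y\<in>inputs N. f X \<noteq> f Y)"

(* States on m qubits are complex vectors of dimension 2 ^ m. The computational basis state
   given by an m-bit string is the unit vector whose index is the number with that binary
   expansion, leftmost bit most significant. *)

definition unitary_mat :: "nat \<Rightarrow> complex mat \<Rightarrow> bool" where
  "unitary_mat d U \<longleftrightarrow>
     U \<in> carrier_mat d d \<and> mat_adjoint U * U = 1\<^sub>m d \<and> U * mat_adjoint U = 1\<^sub>m d"

(* In |i,b,z> the part i takes the ceillog2 N (the ceiling of log_2 N) leftmost bits,
   b the next one (bit position m - ceillog2 N - 1, counted from the right, starting at 0),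
   and z the rest. Replacing b by its sum mod 2 with x_i means flipping b exactly if x_i = 1. *)

definition query_index :: "nat \<Rightarrow> nat \<Rightarrow> bool list \<Rightarrow> nat \<Rightarrow> nat" where
  "query_index N m X c =
     (let k = ceillog2 N; i = c div 2 ^ (m - k) in
      if i < N \<and> X ! i then flip_bit (m - k - 1) c else c)"

definition query_mat :: "nat \<Rightarrow> nat \<Rightarrow> bool list \<Rightarrow> complex mat" where
  "query_mat N m X =
     mat (2 ^ m) (2 ^ m) (\<lambda>(r, c). if r = query_index N m X c then 1 else 0)"

(* m must leave room for i and b, and there must be two bits to measure. *)

definition quantum_network :: "nat \<Rightarrow> nat \<Rightarrow> nat \<Rightarrow> (nat \<Rightarrow> complex mat) \<Rightarrow> bool" where
  "quantum_network N m T U \<longleftrightarrow>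
     ceillog2 N + 1 \<le> m \<and> 2 \<le> m \<and> (\<forall>t\<le>T. unitary_mat (2 ^ m) (U t))"

(* final_state N m X U T is  U_T O U_{T-1} O ... U_1 O U_0 |0>. *)

primrec final_state ::
  "nat \<Rightarrow> nat \<Rightarrow> bool list \<Rightarrow> (nat \<Rightarrow> complex mat) \<Rightarrow> nat \<Rightarrow> complex vec" where
  "final_state N m X U 0 = U 0 *\<^sub>v unit_vec (2 ^ m) 0"
| "final_state N m X U (Suc t) = U (Suc t) *\<^sub>v (query_mat N m X *\<^sub>v final_state N m X U t)"

(* The probability that measuring all of v in the computational basis yields an index
   satisfying P; for P depending only on some of the bits, this is the probability when
   just these bits are measured. *)

definition outcome_prob :: "complex vec \<Rightarrow> (nat \<Rightarrow> bool) \<Rightarrow> real" where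
  "outcome_prob v P = (\<Sum>c | c < dim_vec v \<and> P c. (cmod (v $ c))\<^sup>2)"

(* Of the two rightmost bits, the first (bit 1) says whether the answer is conclusive, and
   the second (bit 0) is the answer. *)

definition computes_zero_error ::
  "nat \<Rightarrow> (bool list \<Rightarrow> bool) \<Rightarrow> nat \<Rightarrow> nat \<Rightarrow> (nat \<Rightarrow> complex mat) \<Rightarrow> bool" where
  "computes_zero_error N f m T U \<longleftrightarrow>
     (\<forall>X\<in>inputs N.
        outcome_prob (final_state N m X U T) (\<lambda>c. bit c 1 \<and> bit c 0 \<noteq> f X) = 0 \<and>
        outcome_prob (final_state N m X U T) (\<lambda>c. \<not> bit c 1) < 1 / 2)"

(* The infimum is taken in enat, where a nonempty set of naturals attains it. *)

definition Q0 :: "nat \<Rightarrow> (bool list \<Rightarrow> bool) \<Rightarrow> enat" where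
  "Q0 N f = (INF T \<in> {T. \<exists>m U. quantum_network N m T U \<and> computes_zero_error N f m T U}. enat T)"

end

theory Submission
  imports Defs
begin

text \<open>
  The amplitudes of the final state are polynomials of degree at most \<open>T\<close> in the input bits, so
  the probability of a conclusive answer \<open>b\<close> is a polynomial of degree at most \<open>2 T\<close>. Averaging it
  over all inputs of weight \<open>k\<close> gives a univariate polynomial in \<open>k\<close> of degree at most \<open>2 T\<close>. By
  the zero-error condition it vanishes at every weight on which the function is not \<open>b\<close>, and it is
  positive at the others. Hence each value is taken on at most \<open>2 T\<close> of the \<open>N + 1\<close> weights.
\<close>

section \<open>Functions of low degree\<close>

text \<open>This is the complex span of the monomials \<open>\<Prod>i\<in>S. x_i\<close> with at
  most \<open>d\<close> factors. Bits satisfy \<open>x_i^2 = x_i\<close>, so a set \<open>S\<close>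
  without multiplicities describes every monomial. The inductive form reduces each linear claim to
  monomials.\<close>

inductive_set low_degree :: "nat \<Rightarrow> nat \<Rightarrow> (bool list \<Rightarrow> complex) set" for N d where
  monomial: "S \<subseteq> {..<N} \<Longrightarrow> card S \<le> d \<Longrightarrow> (\<lambda>X. of_bool (\<forall>i\<in>S. X ! i)) \<in> low_degree N d"
| add: "g \<in> low_degree N d \<Longrightarrow> h \<in> low_degree N d \<Longrightarrow> (\<lambda>X. g X + h X) \<in> low_degree N d"
| scale: "g \<in> low_degree N d \<Longrightarrow> (\<lambda>X. a * g X) \<in> low_degree N d"

lemma low_degree_const: "(\<lambda>X. a) \<in> low_degree N d"
  using low_degree.scale[OF low_degree.monomial[of "{}" N d], of a] by simp

lemma low_degree_sum:
  assumes "\<And>i. i \<in> A \<Longrightarrow> g i \<in> low_degree N d"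
  shows "(\<lambda>X. \<Sum>i\<in>A. g i X) \<in> low_degree N d"
  using assms
  by (induction A rule: infinite_finite_induct) (auto intro: low_degree_const low_degree.add)

text \<open>Since bits are idempotent, the monomials of \<open>S\<close> and \<open>R\<close>
  multiply to the monomial of \<open>S \<union> R\<close>, whose size is at most
  \<open>d + e\<close>. Bilinearity does the rest: the outer induction runs over \<open>g\<close>,
  an inner one over \<open>h\<close> with \<open>S\<close> fixed.\<close>

lemma low_degree_mult:
  assumes "g \<in> low_degree N d" and "h \<in> low_degree N e"
  shows "(\<lambda>X. g X * h X) \<in> low_degree N (d + e)"
  using assms(1)
proof induction
  case S: (monomial S)
  show ?case using assms(2)
  proof induction
    case R: (monomial R)
    have "card (S \<union> R) \<le> d + e"
      using card_Un_le[of S R] S R by linarith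
    then have "(\<lambda>X. of_bool (\<forall>i\<in>S \<union> R. X ! i)) \<in> low_degree N (d + e)"
      using S R by (intro low_degree.monomial) auto
    moreover have "(\<lambda>X. of_bool (\<forall>i\<in>S \<union> R. X ! i)) =
        (\<lambda>X. of_bool (\<forall>i\<in>S. X ! i) * of_bool (\<forall>i\<in>R. X ! i) :: complex)"
      by (auto simp: fun_eq_iff)
    ultimately show ?case by simp
  next
    case (add g h)
    then show ?case using low_degree.add by (fastforce simp: distrib_left)
  next
    case (scale g a)
    then show ?case using low_degree.scale[OF scale.IH, of a] by (simp add: mult.left_commute)
  qed
next
  case (add g h)
  then show ?case using low_degree.add by (fastforce simp: distrib_right)
next
  case (scale g a)
  then show ?case using low_degree.scale[OF scale.IH, of a] by (simp add: mult.assoc)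
qed

text \<open>Monomials are real-valued, so conjugation only changes coefficients.\<close>

lemma low_degree_cnj: "g \<in> low_degree N d \<Longrightarrow> (\<lambda>X. cnj (g X)) \<in> low_degree N d"
proof (induction rule: low_degree.induct)
  case (monomial S)
  have "cnj (of_bool P) = of_bool P" for P by simp
  then show ?case using low_degree.monomial[OF monomial] by simp
qed (auto intro: low_degree.add low_degree.scale)

section \<open>Symmetrization\<close>

definition weight_class :: "nat \<Rightarrow> nat \<Rightarrow> bool list set" where
  "weight_class N k = {X \<in> inputs N. hamming_weight X = k}"

text \<open>Reading an input as a characteristic function turns Hamming weight into cardinality, so
  that inputs can be counted as subsets.\<close>

lemma bij_betw_inputs_subsets: "bij_betw (\<lambda>X. {i. i < N \<and> X ! i}) (inputs N) (Pow {..<N})"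
proof (rule bij_betw_byWitness[where f' = "\<lambda>A. map (\<lambda>i. i \<in> A) [0..<N]"])
  show "\<forall>X\<in>inputs N. map (\<lambda>i. i \<in> {i. i < N \<and> X ! i}) [0..<N] = X"
    by (auto simp: inputs_def intro!: nth_equalityI)
  show "\<forall>A\<in>Pow {..<N}. {i. i < N \<and> map (\<lambda>i. i \<in> A) [0..<N] ! i} = A"
    by auto
qed (auto simp: inputs_def)

lemma finite_weight_class: "finite (weight_class N k)"
proof -
  have "finite (inputs N)"
    using bij_betw_finite[OF bij_betw_inputs_subsets] by simp
  then show ?thesis by (simp add: weight_class_def)
qed

text \<open>Removing \<open>S\<close> leaves an arbitrary subset of \<open>V - S\<close> of size
  \<open>k - card S\<close>. The case \<open>k < card S\<close> is separate because truncated
  subtraction would make the binomial coefficient 1 instead of 0.\<close>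

lemma card_supersets:
  assumes "finite V" and "S \<subseteq> V"
  shows "card {A. A \<subseteq> V \<and> card A = k \<and> S \<subseteq> A} =
    (if card S \<le> k then (card V - card S) choose (k - card S) else 0)"
proof (cases "card S \<le> k")
  case True
  have fin: "finite A" if "A \<subseteq> V" for A
    using that assms(1) finite_subset by blast
  have "bij_betw (\<lambda>B. B \<union> S) {B. B \<subseteq> V - S \<and> card B = k - card S}
      {A. A \<subseteq> V \<and> card A = k \<and> S \<subseteq> A}"
  proof (rule bij_betw_byWitness[where f' = "\<lambda>A. A - S"])
    show "(\<lambda>B. B \<union> S) ` {B. B \<subseteq> V - S \<and> card B = k - card S}
        \<subseteq> {A. A \<subseteq> V \<and> card A = k \<and> S \<subseteq> A}"
    proof safe
      fix B assume B: "B \<subseteq> V - S" "card B = k - card S"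
      have "card (B \<union> S) = card B + card S"
        using B assms fin by (intro card_Un_disjoint) auto
      then show "card (B \<union> S) = k" using B True by simp
    qed (use assms in auto)
    show "(\<lambda>A. A - S) ` {A. A \<subseteq> V \<and> card A = k \<and> S \<subseteq> A}
        \<subseteq> {B. B \<subseteq> V - S \<and> card B = k - card S}"
      using fin assms by (auto simp: card_Diff_subset)
  qed auto
  then have "card {A. A \<subseteq> V \<and> card A = k \<and> S \<subseteq> A} = card {B. B \<subseteq> V - S \<and> card B = k - card S}"
    by (simp add: bij_betw_same_card)
  also have "\<dots> = card (V - S) choose (k - card S)"
    using assms by (intro n_subsets) auto
  finally show ?thesis
    using True assms fin by (simp add: card_Diff_subset)
next
  case False
  have "\<not> S \<subseteq> A" if "A \<subseteq> V" "card A = k" for A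
    using False that assms card_mono[of A S] finite_subset by blast
  then have empty: "{A. A \<subseteq> V \<and> card A = k \<and> S \<subseteq> A} = {}" by blast
  show ?thesis unfolding empty using False by simp
qed

lemma card_weight_class_ones:
  assumes "S \<subseteq> {..<N}"
  shows "card {X \<in> weight_class N k. \<forall>i\<in>S. X ! i} =
    (if card S \<le> k then (N - card S) choose (k - card S) else 0)"
proof -
  let ?F = "\<lambda>X. {i. i < N \<and> X ! i}"
  have "bij_betw ?F {X \<in> weight_class N k. \<forall>i\<in>S. X ! i} {A. A \<subseteq> {..<N} \<and> card A = k \<and> S \<subseteq> A}"
  proof (rule bij_betw_subset[OF bij_betw_inputs_subsets])
    show "?F ` {X \<in> weight_class N k. \<forall>i\<in>S. X ! i} = {A. A \<subseteq> {..<N} \<and> card A = k \<and> S \<subseteq> A}"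
    proof (intro equalityI subsetI)
      fix A assume A: "A \<in> {A. A \<subseteq> {..<N} \<and> card A = k \<and> S \<subseteq> A}"
      then have "A \<in> ?F ` inputs N"
        using bij_betw_imp_surj_on[OF bij_betw_inputs_subsets[of N]] by auto
      then obtain X where X: "X \<in> inputs N" "?F X = A"
        by blast
      then have "X \<in> {X \<in> weight_class N k. \<forall>i\<in>S. X ! i}"
        using A by (auto simp: weight_class_def inputs_def hamming_weight_def)
      then show "A \<in> ?F ` {X \<in> weight_class N k. \<forall>i\<in>S. X ! i}"
        using X by blast
    qed (use assms in \<open>auto simp: weight_class_def inputs_def hamming_weight_def\<close>)
  qed (auto simp: weight_class_def)
  then have "card {X \<in> weight_class N k. \<forall>i\<in>S. X ! i} =
      card {A. A \<subseteq> {..<N} \<and> card A = k \<and> S \<subseteq> A}"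
    by (rule bij_betw_same_card)
  then show ?thesis
    using card_supersets[OF _ assms, of k] by simp
qed

lemma weight_class_nonempty:
  assumes "k \<le> N"
  shows "weight_class N k \<noteq> {}"
proof -
  have "card {X \<in> weight_class N k. \<forall>i\<in>{}. X ! i} > 0"
    using card_weight_class_ones[of "{}" N k] assms by simp
  then show ?thesis by (auto simp: card_gt_0_iff)
qed

lemma hamming_weight_le: "X \<in> inputs N \<Longrightarrow> hamming_weight X \<le> N"
  using card_mono[of "{..<N}" "{i. i < N \<and> X ! i}"]
  by (auto simp: inputs_def hamming_weight_def)

text \<open>The witness is the falling factorial \<open>x (x - 1) ... (x - s + 1)\<close> divided by
  \<open>s!\<close>. It vanishes at every natural \<open>k < s\<close>, in agreement with
  \<open>k choose s\<close>.\<close>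

lemma binomial_poly:
  obtains q :: "'a :: field_char_0 poly"
  where "degree q \<le> s" and "\<And>k. poly q (of_nat k) = of_nat (k choose s)"
proof
  let ?q = "smult (1 / fact s) (\<Prod>i = 0..<s. [:- of_nat i, 1:]) :: 'a poly"
  have "degree (\<Prod>i = 0..<s. [:- of_nat i, 1:] :: 'a poly) \<le> (\<Sum>i = 0..<s. 1)"
    by (rule order_trans[OF degree_prod_sum_le]) auto
  then show "degree ?q \<le> s"
    using degree_smult_le order_trans by fastforce
  show "poly ?q (of_nat k) = of_nat (k choose s)" for k
    by (simp add: binomial_gbinomial gbinomial_prod_rev poly_prod)
qed

text \<open>Here \<open>p\<close> is the average over a weight class, written without division. By
  linearity it suffices to treat a monomial with \<open>s\<close> factors. It is 1 on
  \<open>(N - s) choose (k - s)\<close> inputs of weight \<open>k\<close>, and dividing by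
  \<open>N choose k\<close> gives \<open>(k choose s) / (N choose s)\<close>, of degree
  \<open>s\<close> in \<open>k\<close>.\<close>

lemma low_degree_symmetrize:
  assumes "g \<in> low_degree N d"
  shows "\<exists>p. degree p \<le> d \<and>
    (\<forall>k\<le>N. (\<Sum>X\<in>weight_class N k. g X) = of_nat (N choose k) * poly p (of_nat k))"
  using assms
proof induction
  case (monomial S)
  obtain q :: "complex poly" where q: "degree q \<le> card S"
    "\<And>k. poly q (of_nat k) = of_nat (k choose card S)"
    using binomial_poly by metis
  let ?s = "card S"
  let ?p = "smult (1 / of_nat (N choose ?s)) q"
  have s: "?s \<le> N"
    using monomial card_mono[of "{..<N}" S] by simp
  then have nz: "(N choose ?s) \<noteq> 0" by simp
  have "(\<Sum>X\<in>weight_class N k. of_bool (\<forall>i\<in>S. X ! i)) = of_nat (N choose k) * poly ?p (of_nat k)"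
    if k: "k \<le> N" for k
  proof -
    have "(\<Sum>X\<in>weight_class N k. of_bool (\<forall>i\<in>S. X ! i)) =
        (of_nat (card {X \<in> weight_class N k. \<forall>i\<in>S. X ! i}) :: complex)"
      using finite_weight_class[of N k] by (simp add: sum.If_cases of_bool_def Int_def)
    also have "\<dots> = (of_nat (if ?s \<le> k then (N - ?s) choose (k - ?s) else 0) :: complex)"
      by (subst card_weight_class_ones[OF monomial(1)]) (rule refl)
    also have "\<dots> = of_nat (N choose k) * of_nat (k choose ?s) / of_nat (N choose ?s)"
    \<comment> \<open>For \<open>?s \<le> k\<close> both sides count pairs of nested subsets of
      sizes \<open>?s\<close> and \<open>k\<close>; for \<open>k < ?s\<close> both sides are
      0.\<close>
    proof (cases "?s \<le> k")
      case True
      have "(of_nat (N choose k) * of_nat (k choose ?s) :: complex) =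
          of_nat (N choose ?s) * of_nat ((N - ?s) choose (k - ?s))"
        using choose_mult[OF True k] by (metis of_nat_mult)
      then show ?thesis using True nz by simp
    qed simp
    finally show ?thesis using q by simp
  qed
  moreover have "degree ?p \<le> d"
    using q monomial degree_smult_le[of "1 / of_nat (N choose ?s)" q] by linarith
  ultimately show ?case by blast
next
  case (add g h)
  then obtain p q where
    p: "degree p \<le> d"
      "\<forall>k\<le>N. (\<Sum>X\<in>weight_class N k. g X) = of_nat (N choose k) * poly p (of_nat k)" and
    q: "degree q \<le> d"
      "\<forall>k\<le>N. (\<Sum>X\<in>weight_class N k. h X) = of_nat (N choose k) * poly q (of_nat k)"
    by blast
  then show ?case
    by (intro exI[of _ "p + q"]) (auto simp: degree_add_le sum.distrib distrib_left)
next
  case (scale g a)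
  then obtain p where
    p: "degree p \<le> d"
      "\<forall>k\<le>N. (\<Sum>X\<in>weight_class N k. g X) = of_nat (N choose k) * poly p (of_nat k)"
    by blast
  then have "degree (smult a p) \<le> d"
    using degree_smult_le order_trans by blast
  with p show ?case
    by (intro exI[of _ "smult a p"]) (auto simp flip: sum_distrib_left)
qed

section \<open>Amplitudes of a query network\<close>

lemma query_mat_carrier: "query_mat N m X \<in> carrier_mat (2 ^ m) (2 ^ m)"
  by (simp add: query_mat_def)

lemma final_state_carrier:
  assumes "\<forall>t\<le>T. U t \<in> carrier_mat (2 ^ m) (2 ^ m)" and "t \<le> T"
  shows "final_state N m X U t \<in> carrier_vec (2 ^ m)"
  using assms(2)
  by (induction t) (use assms(1) query_mat_carrier in \<open>auto intro!: mult_mat_vec_carrier\<close>)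

lemma mult_mat_vec_index:
  assumes "A \<in> carrier_mat n k" and "v \<in> carrier_vec k" and "r < n"
  shows "(A *\<^sub>v v) $ r = (\<Sum>c<k. A $$ (r, c) * v $ c)"
  using assms by (auto simp: scalar_prod_def lessThan_atLeast0 intro!: sum.cong)

lemma low_degree_mult_mat_vec:
  assumes A: "\<And>X. A X \<in> carrier_mat n k" and v: "\<And>X. v X \<in> carrier_vec k"
    and "\<And>r c. r < n \<Longrightarrow> c < k \<Longrightarrow> (\<lambda>X. A X $$ (r, c)) \<in> low_degree N d"
    and "\<And>c. c < k \<Longrightarrow> (\<lambda>X. v X $ c) \<in> low_degree N e"
    and "r < n"
  shows "(\<lambda>X. (A X *\<^sub>v v X) $ r) \<in> low_degree N (d + e)"
  unfolding mult_mat_vec_index[OF A v \<open>r < n\<close>]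
  using assms by (intro low_degree_sum low_degree_mult) auto

text \<open>The column \<open>c\<close> determines which bit is queried. That one bit selects
  between the row indices \<open>c\<close> and \<open>a\<close>, so the entry is affine in
  \<open>x_i\<close>, or constant when \<open>i\<close> is out of range.\<close>

lemma low_degree_query_mat:
  assumes "r < 2 ^ m" and "c < 2 ^ m"
  shows "(\<lambda>X. query_mat N m X $$ (r, c)) \<in> low_degree N 1"
proof -
  define k where "k = ceillog2 N"
  define i where "i = c div 2 ^ (m - k)"
  define a where "a = flip_bit (m - k - 1) c"
  show ?thesis
  proof (cases "i < N")
    case True
    have x: "(\<lambda>X. of_bool (X ! i)) \<in> low_degree N 1"
      using low_degree.monomial[of "{i}" N 1] True by simp
    have "(\<lambda>X. of_bool (r = c) + (of_bool (r = a) - of_bool (r = c)) * of_bool (X ! i))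
        \<in> low_degree N 1"
      by (intro low_degree.add low_degree.scale low_degree_const x)
    moreover have "(\<lambda>X. query_mat N m X $$ (r, c)) =
        (\<lambda>X. of_bool (r = c) + (of_bool (r = a) - of_bool (r = c)) * of_bool (X ! i))"
      using assms True
      by (auto simp: fun_eq_iff query_mat_def query_index_def Let_def a_def i_def k_def)
    ultimately show ?thesis by simp
  next
    case False
    then have "(\<lambda>X. query_mat N m X $$ (r, c)) = (\<lambda>X. of_bool (r = c))"
      using assms by (auto simp: fun_eq_iff query_mat_def query_index_def Let_def i_def k_def)
    then show ?thesis by (simp add: low_degree_const)
  qed
qed

text \<open>Each query raises the degree by at most one; the unitaries have entries independent of
  \<open>X\<close> and contribute degree 0.\<close>

lemma low_degree_final_state:
  assumes U: "\<forall>t\<le>T. U t \<in> carrier_mat (2 ^ m) (2 ^ m)" and "t \<le> T" and "r < 2 ^ m"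
  shows "(\<lambda>X. final_state N m X U t $ r) \<in> low_degree N t"
  using assms(2,3)
proof (induction t arbitrary: r)
  case 0
  then show ?case by (simp add: low_degree_const)
next
  case (Suc t)
  have s: "final_state N m X U t \<in> carrier_vec (2 ^ m)" for X
    using final_state_carrier[OF U] Suc.prems by simp
  have queried: "(\<lambda>X. (query_mat N m X *\<^sub>v final_state N m X U t) $ c) \<in> low_degree N (1 + t)"
    if "c < 2 ^ m" for c
    by (rule low_degree_mult_mat_vec[OF query_mat_carrier s low_degree_query_mat])
      (use Suc that in auto)
  have "(\<lambda>X. (U (Suc t) *\<^sub>v (query_mat N m X *\<^sub>v final_state N m X U t)) $ r)
      \<in> low_degree N (0 + (1 + t))"
    by (rule low_degree_mult_mat_vec[OF _ mult_mat_vec_carrier[OF query_mat_carrier s]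
          low_degree_const])
      (use Suc.prems U queried in auto)
  then show ?case by simp
qed

section \<open>Preservation of the norm\<close>

text \<open>This form shows that a probability is polynomial in the amplitudes and their
  conjugates.\<close>

lemma outcome_prob_cnj:
  "complex_of_real (outcome_prob v P) = (\<Sum>c | c < dim_vec v \<and> P c. v $ c * cnj (v $ c))"
  by (simp add: outcome_prob_def complex_norm_square[symmetric] del: of_real_power)

text \<open>With the trivial predicate, \<open>outcome_prob\<close> is the squared norm. Expanding
  it and summing over rows first leaves the inner products of the columns of \<open>U\<close>, which
  are orthonormal.\<close>

lemma outcome_prob_unitary:
  assumes "unitary_mat n U" and v: "v \<in> carrier_vec n"
  shows "outcome_prob (U *\<^sub>v v) (\<lambda>_. True) = outcome_prob v (\<lambda>_. True)"
proof -
  have U: "U \<in> carrier_mat n n" and adj: "mat_adjoint U * U = 1\<^sub>m n"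
    using assms(1) by (auto simp: unitary_mat_def)
  have orth: "(\<Sum>r<n. cnj (U $$ (r, k)) * U $$ (r, j)) = of_bool (k = j)"
    if "k < n" "j < n" for k j
  proof -
    have "(mat_adjoint U * U) $$ (k, j) = (\<Sum>r<n. cnj (U $$ (r, k)) * U $$ (r, j))"
      using that U
      by (auto simp: mat_adjoint_def scalar_prod_def lessThan_atLeast0 intro!: sum.cong)
    moreover have "(mat_adjoint U * U) $$ (k, j) = of_bool (k = j)"
      using adj that by simp
    ultimately show ?thesis by (rule trans[OF sym])
  qed
  have "complex_of_real (outcome_prob (U *\<^sub>v v) (\<lambda>_. True)) =
      (\<Sum>r<n. (U *\<^sub>v v) $ r * cnj ((U *\<^sub>v v) $ r))"
    using U by (simp add: outcome_prob_cnj lessThan_def)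
  also have "\<dots> = (\<Sum>r<n. \<Sum>j<n. \<Sum>k<n. (U $$ (r, j) * v $ j) * cnj (U $$ (r, k) * v $ k))"
    by (rule sum.cong[OF refl])
      (simp add: mult_mat_vec_index[OF U v] sum_product del: complex_cnj_mult)
  also have "\<dots> = (\<Sum>j<n. \<Sum>r<n. \<Sum>k<n. (U $$ (r, j) * v $ j) * cnj (U $$ (r, k) * v $ k))"
    by (rule sum.swap)
  also have "\<dots> = (\<Sum>j<n. \<Sum>k<n. \<Sum>r<n. (U $$ (r, j) * v $ j) * cnj (U $$ (r, k) * v $ k))"
    by (intro sum.cong refl sum.swap)
  also have "\<dots> = (\<Sum>j<n. \<Sum>k<n. v $ j * cnj (v $ k) * (\<Sum>r<n. cnj (U $$ (r, k)) * U $$ (r, j)))"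
    by (simp add: sum_distrib_left mult_ac)
  also have "\<dots> = (\<Sum>j<n. \<Sum>k<n. v $ j * cnj (v $ k) * of_bool (k = j))"
    by (intro sum.cong refl) (simp add: orth)
  also have "\<dots> = (\<Sum>j<n. v $ j * cnj (v $ j))"
    by (simp add: of_bool_def if_distrib cong: if_cong)
  also have "\<dots> = complex_of_real (outcome_prob v (\<lambda>_. True))"
    using v by (simp add: outcome_prob_cnj lessThan_def)
  finally show ?thesis by simp
qed

lemma query_index_less:
  assumes "ceillog2 N + 1 \<le> m" and "c < 2 ^ m"
  shows "query_index N m X c < 2 ^ m"
proof -
  have "take_bit m (flip_bit (m - ceillog2 N - 1) c) = flip_bit (m - ceillog2 N - 1) c"
    using assms by (subst take_bit_flip_bit_eq) (auto simp: take_bit_nat_eq_self)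
  then have "flip_bit (m - ceillog2 N - 1) c < 2 ^ m"
    by (metis take_bit_nat_less_exp)
  then show ?thesis using assms by (simp add: query_index_def Let_def)
qed

text \<open>The flipped bit lies just below the bits of \<open>i\<close>, so the second query sees
  the same \<open>i\<close> and undoes the flip. The assumption gives \<open>?j \<ge> 1\<close>;
  with \<open>?j = 0\<close> the truncated position \<open>?j - 1\<close> would be a bit of
  \<open>i\<close> itself.\<close>

lemma query_index_involution:
  assumes "ceillog2 N + 1 \<le> m"
  shows "query_index N m X (query_index N m X c) = c"
proof -
  let ?j = "m - ceillog2 N"
  have "drop_bit ?j (flip_bit (?j - 1) c) = drop_bit ?j c"
    using assms by (intro bit_eqI) (auto simp: bit_simps)
  then have "flip_bit (?j - 1) c div 2 ^ ?j = c div 2 ^ ?j"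
    by (simp add: drop_bit_eq_div)
  moreover have "flip_bit (?j - 1) (flip_bit (?j - 1) c) = c"
    by (intro bit_eqI) (auto simp: bit_simps)
  ultimately show ?thesis by (auto simp: query_index_def Let_def)
qed

text \<open>The query permutes the basis states, and being an involution it also gives the inverse
  permutation of the entries.\<close>

lemma outcome_prob_query:
  assumes m: "ceillog2 N + 1 \<le> m" and v: "v \<in> carrier_vec (2 ^ m)"
  shows "outcome_prob (query_mat N m X *\<^sub>v v) (\<lambda>_. True) = outcome_prob v (\<lambda>_. True)"
proof -
  let ?q = "query_index N m X"
  have entry: "(query_mat N m X *\<^sub>v v) $ r = v $ ?q r" if "r < 2 ^ m" for r
  proof -
    have "(query_mat N m X *\<^sub>v v) $ r = (\<Sum>c<2 ^ m. query_mat N m X $$ (r, c) * v $ c)"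
      by (rule mult_mat_vec_index[OF query_mat_carrier v that])
    also have "\<dots> = (\<Sum>c<2 ^ m. if c = ?q r then v $ c else 0)"
      using that query_index_involution[OF m, of X]
      by (intro sum.cong) (auto simp: query_mat_def)
    also have "\<dots> = v $ ?q r"
      using query_index_less[OF m that] by simp
    finally show ?thesis .
  qed
  have "bij_betw ?q {..<2 ^ m} {..<2 ^ m}"
    by (rule bij_betw_byWitness[where f' = ?q])
      (use query_index_involution[OF m] query_index_less[OF m] in auto)
  then have "(\<Sum>r<2 ^ m. (cmod (v $ ?q r))\<^sup>2) = (\<Sum>r<2 ^ m. (cmod (v $ r))\<^sup>2)"
    by (rule sum.reindex_bij_betw)
  moreover have "(\<Sum>r<2 ^ m. (cmod ((query_mat N m X *\<^sub>v v) $ r))\<^sup>2) =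
      (\<Sum>r<2 ^ m. (cmod (v $ ?q r))\<^sup>2)"
    by (intro sum.cong) (simp_all add: entry del: index_mult_mat_vec)
  ultimately show ?thesis
    using v carrier_matD[OF query_mat_carrier[of N m X]]
    by (simp add: outcome_prob_def lessThan_def)
qed

lemma outcome_prob_final_state:
  assumes net: "quantum_network N m T U" and "t \<le> T"
  shows "outcome_prob (final_state N m X U t) (\<lambda>_. True) = 1"
  using assms(2)
proof (induction t)
  case 0
  have "outcome_prob (unit_vec (2 ^ m) 0) (\<lambda>_. True) =
      (\<Sum>c<(2 :: nat) ^ m. if c = 0 then 1 else 0)"
    unfolding outcome_prob_def by (intro sum.cong) (auto simp: unit_vec_def)
  then show ?case
    using net outcome_prob_unitary[of "2 ^ m" "U 0" "unit_vec (2 ^ m) 0"]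
    by (simp add: quantum_network_def)
next
  case (Suc t)
  have U: "unitary_mat (2 ^ m) (U (Suc t))" and m: "ceillog2 N + 1 \<le> m"
    using net Suc.prems by (auto simp: quantum_network_def)
  have s: "final_state N m X U t \<in> carrier_vec (2 ^ m)"
    using net Suc.prems
    by (intro final_state_carrier[of T]) (auto simp: quantum_network_def unitary_mat_def)
  show ?case
    using Suc outcome_prob_unitary[OF U mult_mat_vec_carrier[OF query_mat_carrier s]]
      outcome_prob_query[OF m s] by simp
qed

section \<open>The lower bound\<close>

lemma outcome_prob_disj:
  assumes "\<And>c. \<not> (P c \<and> Q c)"
  shows "outcome_prob v (\<lambda>c. P c \<or> Q c) = outcome_prob v P + outcome_prob v Q"
proof -
  have "{c. c < dim_vec v \<and> (P c \<or> Q c)} = {c. c < dim_vec v \<and> P c} \<union> {c. c < dim_vec v \<and> Q c}"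
    by blast
  then show ?thesis
    unfolding outcome_prob_def using assms by (simp add: sum.union_disjoint disjoint_iff)
qed

lemma outcome_prob_nonneg: "outcome_prob v P \<ge> 0"
  by (simp add: outcome_prob_def sum_nonneg)

text \<open>The three outcomes correct, wrong and inconclusive have total probability 1, where wrong
  has probability 0 and inconclusive less than 1/2.\<close>

lemma correct_answer_prob_pos:
  assumes net: "quantum_network N m T U" and comp: "computes_zero_error N f m T U"
    and X: "X \<in> inputs N"
  shows "outcome_prob (final_state N m X U T) (\<lambda>c. bit c 1 \<and> bit c 0 = f X) > 0"
proof -
  let ?v = "final_state N m X U T"
  have "(\<lambda>_::nat. True) =
      (\<lambda>c. (bit c 1 \<and> bit c 0 = f X) \<or> (bit c 1 \<and> bit c 0 \<noteq> f X) \<or> \<not> bit c 1)"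
    by auto
  then have "outcome_prob ?v (\<lambda>_. True) =
      outcome_prob ?v (\<lambda>c. (bit c 1 \<and> bit c 0 = f X) \<or> (bit c 1 \<and> bit c 0 \<noteq> f X) \<or> \<not> bit c 1)"
    by simp
  also have "\<dots> = outcome_prob ?v (\<lambda>c. bit c 1 \<and> bit c 0 = f X) +
      (outcome_prob ?v (\<lambda>c. bit c 1 \<and> bit c 0 \<noteq> f X) + outcome_prob ?v (\<lambda>c. \<not> bit c 1))"
    by (subst outcome_prob_disj, blast)+ simp
  finally show ?thesis
    using outcome_prob_final_state[OF net, of T X] comp X
    by (auto simp: computes_zero_error_def)
qed

text \<open>The symmetrized probability of the conclusive answer \<open>b\<close> has all these
  weights as roots. The input \<open>Y\<close> ensures that this polynomial is not zero, so its
  degree bounds their number.\<close>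

lemma card_other_weights_le:
  assumes net: "quantum_network N m T U" and comp: "computes_zero_error N f m T U"
    and sym: "symmetric_fun N f" and Y: "Y \<in> inputs N" "f Y = b"
  shows "card {k. k \<le> N \<and> (\<exists>X\<in>weight_class N k. f X \<noteq> b)} \<le> 2 * T"
proof -
  let ?K = "{k. k \<le> N \<and> (\<exists>X\<in>weight_class N k. f X \<noteq> b)}"
  \<comment> \<open>The answer \<open>b\<close> is fixed rather than \<open>f X\<close>, so that the
    set of outcomes summed over does not depend on \<open>X\<close>. Amplitude times conjugate then
    has degree \<open>T + T\<close>.\<close>
  define pr where "pr X = outcome_prob (final_state N m X U T) (\<lambda>c. bit c 1 \<and> bit c 0 = b)" for X
  have U: "\<forall>t\<le>T. U t \<in> carrier_mat (2 ^ m) (2 ^ m)"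
    using net by (simp add: quantum_network_def unitary_mat_def)
  have dim: "dim_vec (final_state N m X U T) = 2 ^ m" for X
    using final_state_carrier[OF U, of T] by auto
  have "(\<lambda>X. complex_of_real (pr X)) \<in> low_degree N (T + T)"
    unfolding pr_def outcome_prob_cnj dim
    by (intro low_degree_sum low_degree_mult low_degree_cnj low_degree_final_state[OF U]) auto
  then obtain p where deg: "degree p \<le> 2 * T" and
    p: "\<And>k. k \<le> N \<Longrightarrow>
      complex_of_real (\<Sum>X\<in>weight_class N k. pr X) = of_nat (N choose k) * poly p (of_nat k)"
    using low_degree_symmetrize by (fastforce simp: mult_2)
  have root: "poly p (of_nat k) = 0" if "k \<in> ?K" for k
  proof -
    have "pr X = 0" if "X \<in> weight_class N k" for X
    proof -
      \<comment> \<open>Symmetry carries the value from one witness to the whole weight class; hence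
        answering \<open>b\<close> is an error on all of it.\<close>
      have "f X \<noteq> b"
        using that \<open>k \<in> ?K\<close> sym by (auto simp: symmetric_fun_def weight_class_def)
      moreover have "X \<in> inputs N"
        using that by (simp add: weight_class_def)
      ultimately show ?thesis
        using comp unfolding computes_zero_error_def pr_def by (cases b; cases "f X"; fastforce)
    qed
    then show ?thesis using p[of k] that by simp
  qed
  let ?l = "hamming_weight Y"
  have "pr Y > 0"
    using correct_answer_prob_pos[OF net comp Y(1)] Y(2) by (simp add: pr_def)
  \<comment> \<open>The summands are nonnegative and the one at \<open>Y\<close> is positive, so
    \<open>p\<close> does not vanish at \<open>?l\<close>.\<close>
  then have "(\<Sum>X\<in>weight_class N ?l. pr X) > 0"
    using Y by (intro sum_pos2[of _ Y] finite_weight_class)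
      (auto simp: weight_class_def pr_def outcome_prob_nonneg)
  then have "p \<noteq> 0"
    using p[OF hamming_weight_le[OF Y(1)]] by (auto simp del: of_real_sum)
  have "card ?K = card (of_nat ` ?K :: complex set)"
    by (simp add: card_image inj_on_def)
  also have "\<dots> \<le> card {x. poly p x = 0}"
    using root by (intro card_mono poly_roots_finite \<open>p \<noteq> 0\<close>) auto
  also have "\<dots> \<le> degree p"
    by (rule card_poly_roots_bound[OF \<open>p \<noteq> 0\<close>])
  finally show ?thesis using deg by simp
qed

text \<open>Every weight up to \<open>N\<close> occurs, and the value of \<open>f\<close> there
  differs from \<open>True\<close> or from \<open>False\<close>. So two sets of at most
  \<open>2 * T\<close> weights cover all \<open>N + 1\<close>. Nonconstancy supplies the input
  \<open>Y\<close> for each \<open>b\<close>.\<close>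

lemma zero_error_queries_bound:
  assumes net: "quantum_network N m T U" and comp: "computes_zero_error N f m T U"
    and sym: "symmetric_fun N f" and nonconst: "nonconstant_fun N f"
  shows "N + 1 \<le> 4 * T"
proof -
  let ?K = "\<lambda>b. {k. k \<le> N \<and> (\<exists>X\<in>weight_class N k. f X \<noteq> b)}"
  have card_K: "card (?K b) \<le> 2 * T" for b
  proof -
    obtain Y where "Y \<in> inputs N" "f Y = b"
      using nonconst unfolding nonconstant_fun_def by (cases b) auto
    then show ?thesis by (rule card_other_weights_le[OF net comp sym])
  qed
  have "{..N} \<subseteq> ?K True \<union> ?K False"
    using weight_class_nonempty by fastforce
  then have "N + 1 \<le> card (?K True \<union> ?K False)"
    using card_mono[of "?K True \<union> ?K False" "{..N}"] by simp
  also have "\<dots> \<le> card (?K True) + card (?K False)"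
    by (rule card_Un_le)
  finally show ?thesis using card_K[of True] card_K[of False] by linarith
qed

theorem theorem4p5:
  fixes N :: nat and f :: "bool list \<Rightarrow> bool"
  assumes "N \<ge> 1"
    and "symmetric_fun N f"
    and "nonconstant_fun N f"
  shows "ereal_of_enat (Q0 N f) \<ge> ereal ((real N + 1) / 4)"
proof -
  \<comment> \<open>\<open>(N + 4) div 4\<close> is the ceiling of \<open>(N + 1) / 4\<close>, so
    the bound can be proved for the infimum inside \<open>enat\<close>. If no network exists, the
    infimum is infinite and the bound still holds.\<close>
  have "enat ((N + 4) div 4) \<le> Q0 N f"
    unfolding Q0_def
    by (rule INF_greatest) (use zero_error_queries_bound assms(2,3) in fastforce)
  then have "ereal (real ((N + 4) div 4)) \<le> ereal_of_enat (Q0 N f)"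
    by (metis ereal_of_enat_le_iff ereal_of_enat_simps(1))
  moreover have "(real N + 1) / 4 \<le> real ((N + 4) div 4)"
  proof -
    have "N + 1 \<le> 4 * ((N + 4) div 4)" by presburger
    then have "real (N + 1) \<le> real (4 * ((N + 4) div 4))" by (rule of_nat_mono)
    then show ?thesis by simp
  qed
  ultimately show ?thesis
    by (meson ereal_less_eq(3) order_trans)
qed

end
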